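(* Let $\theta:\mathbb{R}^n\to(-\infty,\infty]$ be a closed proper convex function and let $\gamma\in(0,2)$. (i) Let $F:\mathbb{R}^n\to\mathbb{R}^n$ be monotone and Lipschitz continuous with constant $L>0$, such that $\mathrm{MGVI}(\theta,F)$ has at least one solution, and let $\nu\in(0,1)$. Let $\{x^k\}_k$ be a sequence generated by the algorithm $\mathrm{PGA}_{b_1}$ (defined in the context) from an arbitrary starting point, with step sizes $\{\beta^k\}_k$ that are bounded and satisfy $\inf_k\beta^k>0$. Then $\{x^k\}_k$ converges to a solution of $\mathrm{MGVI}(\theta,F)$. (ii) Let $F(x)=Ax+c$ with $A\in\mathbb{R}^{n\times n}$ symmetric positive semi-definite and $c\in\mathbb{R}^n$, such that $\mathrm{MGVI}(\theta,F)$ has at least one solution, and let $\beta>0$ satisfy $\beta<\frac{1}{\lambda_{\max}(A)}$. Let $\{y^k\}_k$ be a sequence generated by the algorithm $\mathrm{PGA}_{b_2}$ (defined in the context) from an arbitrary starting point. Then $\{y^k\}_k$ converges to a solution of $\mathrm{MGVI}(\theta,F)$.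
   Context: $\mathbb{R}^n$ carries the standard inner product and Euclidean norm $\|\cdot\|$. A function is closed proper convex if its epigraph is closed and convex and its effective domain $\{x:\theta(x)<\infty\}$ is nonempty. $F$ is monotone if $(F(x)-F(y))^T(x-y)\ge 0$ for all $x,y\in\mathbb{R}^n$. A solution of $\mathrm{MGVI}(\theta,F)$ is a point $x^*\in\mathbb{R}^n$ with $\theta(x)-\theta(x^* )+(x-x^* )^TF(x^* )\ge 0$ for all $x\in\mathbb{R}^n$ (with the convention $\infty-\infty=\infty$). For a closed proper convex $f$, $\mathrm{Prox}_f(x)$ is the unique minimizer over $y\in\mathbb{R}^n$ of $f(y)+\frac12\|x-y\|^2$. $\lambda_{\max}(A)$ is the largest eigenvalue of $A$ (if $\lambda_{\max}(A)=0$, the condition $\beta<1/\lambda_{\max}(A)$ is void). Algorithm $\mathrm{PGA}_{b_1}$: given $x^0\in\mathbb{R}^n$, $\nu\in(0,1)$ and $\gamma\in(0,2)$, for $k=0,1,2,\dots$: (Predictor) select $\beta^k>0$ such that $\beta^k\|F(x^k)-F(\tilde x^k)\|\le\nu\|x^k-\tilde x^k\|$, where $\tilde x^k=\mathrm{Prox}_{\beta^k\theta}(x^k-\beta^kF(x^k))$; (Corrector) set $d^k=(x^k-\tilde x^k)-\beta^k(F(x^k)-F(\tilde x^k))$, $\alpha_k^*=\dfrac{(x^k-\tilde x^k)^Td^k}{\|d^k\|^2}$, and $x^{k+1}=x^k-\gamma\alpha_k^*d^k$. Convention: if $x^k=\tilde x^k$ (so that $\alpha_k^*$ is $0/0$),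 then $x^{k+1}=x^k$. Algorithm $\mathrm{PGA}_{b_2}$ (iterates again denoted $x^k$): given $x^0\in\mathbb{R}^n$, $\beta>0$ and $\gamma\in(0,2)$, for $k=0,1,2,\dots$: (Predictor) set $\tilde x^k=\mathrm{Prox}_{\beta\theta}(x^k-\beta F(x^k))$; (Corrector) set $x^{k+1}=x^k-\gamma(x^k-\tilde x^k)$. *)

theory Defs
  imports "HOL-Analysis.Analysis"
begin

text \<open>The library constant \<open>epigraph\<close> is restricted to real-valued functions.\<close>

definition ereal_epigraph :: "('a \<Rightarrow> ereal) \<Rightarrow> ('a \<times> real) set" where
  "ereal_epigraph f = {(x, r). f x \<le> ereal r}"

definition effective_domain :: "('a \<Rightarrow> ereal) \<Rightarrow> 'a set" where
  "effective_domain f = {x. f x < \<infinity>}"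

text \<open>The first conjunct expresses that \<open>f\<close> takes its values in \<open>(-\<infinity>, \<infinity>]\<close>.\<close>

definition closed_proper_convex :: "('a::euclidean_space \<Rightarrow> ereal) \<Rightarrow> bool" where
  "closed_proper_convex f \<longleftrightarrow>
     (\<forall>x. f x \<noteq> -\<infinity>) \<and> closed (ereal_epigraph f) \<and> convex (ereal_epigraph f) \<and>
     effective_domain f \<noteq> {}"

definition monotone_operator :: "('a::real_inner \<Rightarrow> 'a) \<Rightarrow> bool" where
  "monotone_operator F \<longleftrightarrow> (\<forall>x y. 0 \<le> (F x - F y) \<bullet> (x - y))"

text \<open>Subtraction on \<^typ>\<open>ereal\<close> satisfies \<open>\<infinity> - \<infinity> = \<infinity>\<close>, which is the convention needed here.\<close>

definition MGVI_solution :: "('a::real_inner \<Rightarrow> ereal) \<Rightarrow> ('a \<Rightarrow> 'a) \<Rightarrow> 'a \<Rightarrow> bool" where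
  "MGVI_solution \<theta> F s \<longleftrightarrow> (\<forall>x. 0 \<le> \<theta> x - \<theta> s + ereal ((x - s) \<bullet> F s))"

definition Prox :: "('a::euclidean_space \<Rightarrow> ereal) \<Rightarrow> 'a \<Rightarrow> 'a" where
  "Prox f x =
     (THE y. is_arg_min (\<lambda>y. f y + ereal (1 / 2 * (norm (x - y))\<^sup>2)) (\<lambda>_. True) y)"

definition predictor ::
    "('a::euclidean_space \<Rightarrow> ereal) \<Rightarrow> ('a \<Rightarrow> 'a) \<Rightarrow> real \<Rightarrow> 'a \<Rightarrow> 'a" where
  "predictor \<theta> F b x = Prox (\<lambda>y. ereal b * \<theta> y) (x - b *\<^sub>R F x)"

text \<open>
  \<open>PGA_b1 \<theta> F \<nu> \<gamma> \<beta> x\<close>: the sequence \<open>x\<close> is generated, from its starting point \<open>x 0\<close>, with the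
  selected step sizes \<open>\<beta>\<close>.
\<close>

definition PGA_b1 ::
    "('a::euclidean_space \<Rightarrow> ereal) \<Rightarrow> ('a \<Rightarrow> 'a) \<Rightarrow> real \<Rightarrow> real \<Rightarrow> (nat \<Rightarrow> real) \<Rightarrow> (nat \<Rightarrow> 'a) \<Rightarrow> bool"
  where
  "PGA_b1 \<theta> F \<nu> \<gamma> \<beta> x \<longleftrightarrow>
     (\<forall>k. let xt = predictor \<theta> F (\<beta> k) (x k);
              d = (x k - xt) - \<beta> k *\<^sub>R (F (x k) - F xt);
              \<alpha> = ((x k - xt) \<bullet> d) / (norm d)\<^sup>2
          in 0 < \<beta> k \<and>
             \<beta> k * norm (F (x k) - F xt) \<le> \<nu> * norm (x k - xt) \<and>
             x (Suc k) = (if x k = xt then x k else x k - (\<gamma> * \<alpha>) *\<^sub>R d))"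

definition PGA_b2 ::
    "('a::euclidean_space \<Rightarrow> ereal) \<Rightarrow> ('a \<Rightarrow> 'a) \<Rightarrow> real \<Rightarrow> real \<Rightarrow> (nat \<Rightarrow> 'a) \<Rightarrow> bool" where
  "PGA_b2 \<theta> F \<gamma> \<beta> x \<longleftrightarrow>
     (\<forall>k. x (Suc k) = x k - \<gamma> *\<^sub>R (x k - predictor \<theta> F \<beta> (x k)))"

definition symmetric_psd :: "real^'n^'n \<Rightarrow> bool" where
  "symmetric_psd A \<longleftrightarrow> transpose A = A \<and> (\<forall>x. 0 \<le> x \<bullet> (A *v x))"

definition eigenvalues :: "real^'n^'n \<Rightarrow> real set" where
  "eigenvalues A = {l. \<exists>v. v \<noteq> 0 \<and> A *v v = l *\<^sub>R v}"

text \<open>Only used for symmetric \<open>A\<close>, whose set of (real) eigenvalues is finite and nonempty.\<close>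

definition lambda_max :: "real^'n^'n \<Rightarrow> real" where
  "lambda_max A = Max (eigenvalues A)"

end

theory Submission
  imports Defs
begin

text \<open>
  Write \<open>xt\<close> for the predictor at \<open>x\<close>, \<open>p = x - xt\<close>, and \<open>d = p - b *\<^sub>R (F x - F xt)\<close>.
  The optimality condition of the proximal problem is a variational inequality for \<open>xt\<close>. Testing
  it at a solution \<open>s\<close>, testing the variational inequality of \<open>s\<close> at \<open>xt\<close>, and using
  monotonicity of \<open>F\<close> between \<open>xt\<close> and \<open>s\<close> gives \<open>(xt - s) \<bullet> d \<ge> 0\<close>, that is,
  \<open>p \<bullet> d \<le> (x - s) \<bullet> d\<close> (\<open>predictor_descent_direction\<close>): the direction \<open>- d\<close>, which is
  computed without knowing \<open>s\<close>, points towards every solution.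

  This makes both iterations strictly Fejer monotone. With variable step sizes, the step
  criterion makes \<open>p \<bullet> d\<close> and \<open>(norm d)\<^sup>2\<close> comparable to \<open>(norm p)\<^sup>2\<close>, and the step length
  \<open>\<alpha>\<close> minimizes the resulting upper bound for the squared Euclidean distance to \<open>s\<close>
  (\<open>PGA_b1_contraction\<close>). For \<open>F x = A *v x + c\<close> one has \<open>d = M p\<close> with
  \<open>M = I - \<beta> A\<close>, so the plain step along \<open>- p\<close> decreases the distance
  to \<open>s\<close> in the norm induced by \<open>M\<close>; this is a norm because \<open>\<beta>\<close> times the
  largest eigenvalue, and hence times every Rayleigh quotient, is below \<open>1\<close>.

  In both cases the squared distance to each solution decreases by at least a constant multiple of
  \<open>(norm p)\<^sup>2\<close>. So the iterates are bounded and \<open>p\<close> tends to \<open>0\<close>; passing to the limit in the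
  variational inequality of the predictor, cluster points are solutions
  (\<open>predictor_cluster_point_solution\<close>, where step sizes must stay away from \<open>0\<close>); and
  a Fejer monotone sequence with a cluster point in the target set converges to it
  (\<open>fejer_monotone_convergence\<close>).

  Extended real values are handled through the epigraph throughout: statements about \<open>\<theta> z\<close> are
  phrased as statements about all real \<open>r\<close> with \<open>\<theta> z \<le> ereal r\<close>, which is vacuous outside the
  effective domain.
\<close>

section \<open>Proximal points of closed proper convex functions\<close>

lemma norm_diff_scaleR_squared:
  fixes u w :: "'a::real_inner"
  shows "(norm (u - c *\<^sub>R w))\<^sup>2 = (norm u)\<^sup>2 - 2 * c * (u \<bullet> w) + c\<^sup>2 * (norm w)\<^sup>2"
  unfolding power2_norm_eq_inner
  by (simp add: inner_diff_left inner_diff_right inner_commute[of w u] power2_eq_square algebra_simps)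

lemma epigraph_convex_combination:
  fixes f :: "'a::euclidean_space \<Rightarrow> ereal"
  assumes "closed_proper_convex f" "f y \<le> ereal s" "f z \<le> ereal r" "0 \<le> t" "t \<le> 1"
  shows "f ((1 - t) *\<^sub>R y + t *\<^sub>R z) \<le> ereal ((1 - t) * s + t * r)"
proof -
  have "convex (ereal_epigraph f)" "(y, s) \<in> ereal_epigraph f" "(z, r) \<in> ereal_epigraph f"
    using assms by (auto simp: closed_proper_convex_def ereal_epigraph_def)
  from convexD_alt[OF this assms(4,5)] show ?thesis
    by (simp add: ereal_epigraph_def)
qed

lemma epigraph_limit:
  fixes f :: "'a::euclidean_space \<Rightarrow> ereal"
  assumes "closed_proper_convex f" "\<And>k. f (y k) \<le> ereal (r k)"
    and "y \<longlonglongrightarrow> y'" "r \<longlonglongrightarrow> r'"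
  shows "f y' \<le> ereal r'"
proof -
  have "closed (ereal_epigraph f)"
    using assms(1) by (simp add: closed_proper_convex_def)
  moreover have "\<And>k. (y k, r k) \<in> ereal_epigraph f"
    using assms(2) by (simp add: ereal_epigraph_def)
  moreover have "(\<lambda>k. (y k, r k)) \<longlonglongrightarrow> (y', r')"
    using assms(3,4) by (rule tendsto_Pair)
  ultimately have "(y', r') \<in> ereal_epigraph f"
    by (rule closed_sequentially)
  then show ?thesis by (simp add: ereal_epigraph_def)
qed

lemma finite_point_exists:
  fixes f :: "'a::euclidean_space \<Rightarrow> ereal"
  assumes "closed_proper_convex f"
  obtains y r where "f y = ereal r"
proof -
  obtain y where "f y < \<infinity>" "f y \<noteq> -\<infinity>"
    using assms unfolding closed_proper_convex_def effective_domain_def by blast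
  then have "f y = ereal (real_of_ereal (f y))" by (cases "f y") auto
  then show ?thesis by (rule that)
qed

text \<open>
  Otherwise a sequence in \<open>K\<close> along which \<open>f\<close> tends to \<open>-\<infinity>\<close> has a cluster point, and
  closedness of the epigraph forces the value \<open>-\<infinity>\<close> there.
\<close>

lemma bounded_below_on_compact:
  fixes f :: "'a::euclidean_space \<Rightarrow> ereal"
  assumes f: "closed_proper_convex f" and K: "compact K"
  obtains m where "\<And>y r. y \<in> K \<Longrightarrow> f y \<le> ereal r \<Longrightarrow> m \<le> r"
proof (rule ccontr)
  assume "\<not> thesis"
  then have "\<forall>m. \<exists>y r. y \<in> K \<and> f y \<le> ereal r \<and> r < m"
    using that by (meson not_le)
  then have "\<forall>n::nat. \<exists>y. y \<in> K \<and> f y \<le> ereal (- real n)"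
    by (metis ereal_less_eq(3) less_imp_le order_trans)
  then obtain y where y: "\<And>n. y n \<in> K" "\<And>n. f (y n) \<le> ereal (- real n)"
    by metis
  obtain l and q :: "nat \<Rightarrow> nat" where q: "strict_mono q" "(y \<circ> q) \<longlonglongrightarrow> l"
    using K y(1) unfolding compact_def by metis
  have fl: "f l \<le> ereal (- real N)" for N
  proof (rule epigraph_limit[OF f])
    show "(\<lambda>k. y (q (k + N))) \<longlonglongrightarrow> l"
      using LIMSEQ_ignore_initial_segment[OF q(2), of N] by (simp add: comp_def)
    show "f (y (q (k + N))) \<le> ereal (- real N)" for k
    proof -
      have "N \<le> q (k + N)" using seq_suble[OF q(1), of "k + N"] by simp
      then show ?thesis
        using y(2)[of "q (k + N)"] by (auto intro: order_trans)
    qed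
  qed simp
  have "f l \<noteq> -\<infinity>" using f by (simp add: closed_proper_convex_def)
  with fl[of 0] obtain v where v: "f l = ereal v" by (cases "f l") auto
  obtain N :: nat where "- v < real N" using reals_Archimedean2 by blast
  with fl[of N] v show False by simp
qed

text \<open>
  This replaces an affine minorant of \<open>f\<close> and needs no separation theorem. On the unit ball around a point
  \<open>x0\<close> of the domain, \<open>f\<close> is bounded below; convexity along the segment from \<open>x0\<close> to a
  distant \<open>y\<close>, which crosses the unit sphere, then bounds \<open>f y\<close> below linearly in the distance.
\<close>

lemma linear_lower_growth:
  fixes f :: "'a::euclidean_space \<Rightarrow> ereal"
  assumes f: "closed_proper_convex f"
  obtains a where "0 \<le> a" "\<And>y r. f y \<le> ereal r \<Longrightarrow> - (a * (1 + norm (x - y))) \<le> r"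
proof -
  obtain x0 r0 where x0: "f x0 = ereal r0" using finite_point_exists[OF f] .
  obtain m where m: "\<And>y r. y \<in> cball x0 1 \<Longrightarrow> f y \<le> ereal r \<Longrightarrow> m \<le> r"
    using bounded_below_on_compact[OF f compact_cball[of x0 1]] by blast
  define c where "c = \<bar>m\<bar> + \<bar>r0\<bar>"
  have c: "0 \<le> c" by (simp add: c_def)
  have growth: "- (c * (1 + norm (y - x0))) \<le> r" if "f y \<le> ereal r" for y r
  proof (cases "norm (y - x0) \<le> 1")
    case True
    then have "m \<le> r" using m that by (simp add: dist_norm norm_minus_commute)
    moreover have "c * 1 \<le> c * (1 + norm (y - x0))" using c by (intro mult_left_mono) auto
    ultimately show ?thesis by (simp add: c_def)
  next
    case False
    define D where "D = norm (y - x0)"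
    have D: "1 < D" using False D_def by simp
    \<comment> \<open>the point where the segment from \<open>x0\<close> to \<open>y\<close> leaves the unit ball around \<open>x0\<close>\<close>
    define z where "z = (1 - 1/D) *\<^sub>R x0 + (1/D) *\<^sub>R y"
    have "z - x0 = (1/D) *\<^sub>R (y - x0)" by (simp add: z_def algebra_simps)
    then have "norm (z - x0) = (1/D) * D" using D by (simp add: D_def)
    then have "norm (z - x0) = 1" using D by simp
    then have "z \<in> cball x0 1" by (simp add: dist_norm norm_minus_commute)
    moreover have "f z \<le> ereal ((1 - 1/D) * r0 + (1/D) * r)"
      unfolding z_def using D x0 that by (intro epigraph_convex_combination[OF f]) auto
    ultimately have "m \<le> (1 - 1/D) * r0 + (1/D) * r" by (rule m)
    then have "D * m \<le> D * ((1 - 1/D) * r0 + (1/D) * r)" using D by (intro mult_left_mono) auto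
    also have "\<dots> = (D - 1) * r0 + r" using D by (simp add: field_simps)
    finally have "D * m - (D - 1) * r0 \<le> r" by simp
    moreover have "D * (- c) \<le> D * (m - r0)"
      using D by (intro mult_left_mono) (auto simp: c_def)
    moreover have "- c \<le> r0" by (simp add: c_def)
    ultimately have "- (c * (1 + D)) \<le> r" by (simp add: algebra_simps)
    then show ?thesis by (simp only: D_def)
  qed
  show ?thesis
  proof
    show "0 \<le> c * (1 + norm (x - x0))" using c by simp
    show "- (c * (1 + norm (x - x0)) * (1 + norm (x - y))) \<le> r" if "f y \<le> ereal r" for y r
    proof -
      have "norm (y - x0) \<le> norm (x - x0) + norm (x - y)"
        using norm_triangle_ineq4[of "x - x0" "x - y"] by simp
      moreover have "0 \<le> norm (x - x0) * norm (x - y)" by simp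
      ultimately have "1 + norm (y - x0) \<le> (1 + norm (x - x0)) * (1 + norm (x - y))"
        unfolding ring_distribs by linarith
      then have "c * (1 + norm (y - x0)) \<le> c * ((1 + norm (x - x0)) * (1 + norm (x - y)))"
        using c by (rule mult_left_mono)
      then show ?thesis using growth[OF that] unfolding mult.assoc by linarith
    qed
  qed
qed

text \<open>
  The objective is lifted to the continuous function \<open>(y, r) \<mapsto> r + (norm (x - y))\<^sup>2 / 2\<close> on the closed
  epigraph. Its sublevel sets there are compact, because the quadratic term dominates the
  linear lower bound on \<open>r\<close>.
\<close>

lemma proximal_minimizer_exists:
  fixes f :: "'a::euclidean_space \<Rightarrow> ereal"
  assumes f: "closed_proper_convex f"
  shows "\<exists>y. is_arg_min (\<lambda>y. f y + ereal (1 / 2 * (norm (x - y))\<^sup>2)) (\<lambda>_. True) y"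
proof -
  obtain a where a: "0 \<le> a" "\<And>y r. f y \<le> ereal r \<Longrightarrow> - (a * (1 + norm (x - y))) \<le> r"
    using linear_lower_growth[OF f] by blast
  obtain x0 r0 where x0: "f x0 = ereal r0" using finite_point_exists[OF f] .
  define g :: "'a \<times> real \<Rightarrow> real" where "g = (\<lambda>p. snd p + 1 / 2 * (norm (x - fst p))\<^sup>2)"
  have g_cont: "continuous_on S g" for S
    unfolding g_def by (intro continuous_intros)
  define M where "M = g (x0, r0)"
  define S where "S = ereal_epigraph f \<inter> {p. g p \<le> M}"
  have "closed S" unfolding S_def
    using f by (intro closed_Int closed_Collect_le g_cont continuous_on_const)
      (auto simp: closed_proper_convex_def)
  moreover have "bounded S"
  proof -
    \<comment> \<open>For \<open>u = norm (x - y) \<ge> 1\<close> the two bounds give \<open>u\<^sup>2 / 2 \<le> (\<bar>M\<bar> + 2 * a) * u\<close>.\<close>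
    define R where "R = 1 + 2 * (2 * a + \<bar>M\<bar>)"
    have R1: "1 \<le> R" using a by (simp add: R_def)
    have R: "norm (x - y) \<le> R" if "(y, r) \<in> S" for y r
    proof (rule ccontr)
      define u where "u = norm (x - y)"
      assume "\<not> norm (x - y) \<le> R"
      then have u: "R < u" by (simp add: u_def)
      have "- (a * (1 + u)) \<le> r" "r + 1 / 2 * u\<^sup>2 \<le> M"
        using that a(2) by (auto simp: S_def u_def ereal_epigraph_def g_def)
      then have "1 / 2 * u\<^sup>2 \<le> M + a * (1 + u)" by linarith
      also have "\<dots> \<le> \<bar>M\<bar> * u + a * (2 * u)"
      proof (intro add_mono mult_left_mono a)
        have "\<bar>M\<bar> * 1 \<le> \<bar>M\<bar> * u" using u R1 by (intro mult_left_mono) auto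
        then show "M \<le> \<bar>M\<bar> * u" by linarith
      qed (use u R1 in auto)
      finally have "u * u \<le> (2 * (2 * a + \<bar>M\<bar>)) * u"
        by (simp add: power2_eq_square algebra_simps)
      then have "u \<le> 2 * (2 * a + \<bar>M\<bar>)" using u R1 by simp
      then show False using u by (simp add: R_def)
    qed
    have "S \<subseteq> cball x R \<times> {- (a * (1 + R))..M}"
    proof
      fix p assume p: "p \<in> S"
      obtain y r where yr: "p = (y, r)" by (cases p)
      have n: "norm (x - y) \<le> R" using R p yr by blast
      have "- (a * (1 + norm (x - y))) \<le> r"
        using a(2) p yr by (simp add: S_def ereal_epigraph_def)
      moreover have "a * (1 + norm (x - y)) \<le> a * (1 + R)"
        using n a(1) by (intro mult_left_mono) auto
      moreover have "r \<le> M"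
      proof -
        have "r + 1 / 2 * (norm (x - y))\<^sup>2 \<le> M" using p yr by (simp add: S_def g_def)
        then show ?thesis using zero_le_power2[of "norm (x - y)"] by linarith
      qed
      ultimately show "p \<in> cball x R \<times> {- (a * (1 + R))..M}"
        using n yr by (simp add: dist_norm)
    qed
    then show ?thesis
      by (rule bounded_subset[rotated]) (intro bounded_Times bounded_cball bounded_closed_interval)
  qed
  ultimately have "compact S" by (simp add: compact_eq_bounded_closed)
  moreover have "(x0, r0) \<in> S" using x0 by (simp add: S_def M_def ereal_epigraph_def)
  ultimately obtain p where p: "p \<in> S" "\<And>q. q \<in> S \<Longrightarrow> g p \<le> g q"
    using continuous_attains_inf[of S g] g_cont by blast
  have min: "g p \<le> g q" if "q \<in> ereal_epigraph f" for q
    using p that by (cases "g q \<le> M") (auto simp: S_def)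
  obtain y r where yr: "p = (y, r)" by (cases p)
  have fy: "f y \<le> ereal r" using p(1) yr by (simp add: S_def ereal_epigraph_def)
  have "f y + ereal (1 / 2 * (norm (x - y))\<^sup>2) \<le> f z + ereal (1 / 2 * (norm (x - z))\<^sup>2)" for z
  proof (cases "f z")
    case (real v)
    have "f y + ereal (1 / 2 * (norm (x - y))\<^sup>2) \<le> ereal r + ereal (1 / 2 * (norm (x - y))\<^sup>2)"
      using fy by (rule add_right_mono)
    also have "\<dots> \<le> f z + ereal (1 / 2 * (norm (x - z))\<^sup>2)"
      using min[of "(z, v)"] real yr by (simp add: ereal_epigraph_def g_def)
    finally show ?thesis .
  qed (use f in \<open>auto simp: closed_proper_convex_def\<close>)
  then show ?thesis by (auto simp: is_arg_min_def not_less)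
qed

text \<open>
  Fermat's rule: \<open>x - y\<close> is a subgradient of \<open>f\<close> at the minimizer \<open>y\<close>. Compare \<open>y\<close> with the
  points of the segment towards \<open>z\<close>; after division by the parameter \<open>t\<close>, the quadratic term
  disappears as \<open>t\<close> tends to \<open>0\<close>.
\<close>

lemma proximal_variational_inequality:
  fixes f :: "'a::euclidean_space \<Rightarrow> ereal"
  assumes f: "closed_proper_convex f"
    and y: "is_arg_min (\<lambda>y. f y + ereal (1 / 2 * (norm (x - y))\<^sup>2)) (\<lambda>_. True) y"
  obtains v where "f y = ereal v" "\<And>z r. f z \<le> ereal r \<Longrightarrow> v + (x - y) \<bullet> (z - y) \<le> r"
proof -
  have min: "f y + ereal (1 / 2 * (norm (x - y))\<^sup>2) \<le> f z + ereal (1 / 2 * (norm (x - z))\<^sup>2)" for z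
    using y by (auto simp: is_arg_min_def not_less)
  obtain x0 r0 where x0: "f x0 = ereal r0" using finite_point_exists[OF f] .
  have "f y \<noteq> \<infinity>" using min[of x0] x0 by auto
  moreover have "f y \<noteq> -\<infinity>" using f by (simp add: closed_proper_convex_def)
  ultimately obtain v where v: "f y = ereal v" by (cases "f y") auto
  have "v + (x - y) \<bullet> (z - y) \<le> r" if r: "f z \<le> ereal r" for z r
  proof -
    define D where "D = r - v - (x - y) \<bullet> (z - y)"
    define K where "K = 1 / 2 * (norm (z - y))\<^sup>2"
    have quadratic: "0 \<le> t * ((r - v - X) + t * (1 / 2 * Z))"
      if "v + 1 / 2 * N \<le> (1 - t) * v + t * r + 1 / 2 * (N - 2 * t * X + t\<^sup>2 * Z)" for t N X Z
      using that by (simp add: power2_eq_square algebra_simps)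
    have step: "0 \<le> D + t * K" if t: "0 < t" "t < 1" for t
    proof -
      define w where "w = (1 - t) *\<^sub>R y + t *\<^sub>R z"
      have fw: "f w \<le> ereal ((1 - t) * v + t * r)"
        unfolding w_def using v r t by (intro epigraph_convex_combination[OF f]) auto
      have "f y + ereal (1 / 2 * (norm (x - y))\<^sup>2)
          \<le> ereal ((1 - t) * v + t * r) + ereal (1 / 2 * (norm (x - w))\<^sup>2)"
        by (rule order_trans[OF min[of w] add_right_mono[OF fw]])
      then have opt: "v + 1 / 2 * (norm (x - y))\<^sup>2 \<le> (1 - t) * v + t * r + 1 / 2 * (norm (x - w))\<^sup>2"
        by (simp add: v)
      have xw: "x - w = (x - y) - t *\<^sub>R (z - y)" by (simp add: w_def algebra_simps)
      have "v + 1 / 2 * (norm (x - y))\<^sup>2 \<le> (1 - t) * v + t * r + 1 / 2 *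
          ((norm (x - y))\<^sup>2 - 2 * t * ((x - y) \<bullet> (z - y)) + t\<^sup>2 * (norm (z - y))\<^sup>2)"
        using opt unfolding xw norm_diff_scaleR_squared .
      then have "0 \<le> t * (D + t * K)"
        unfolding D_def K_def
        by (intro quadratic[where N = "(norm (x - y))\<^sup>2"])
      then show ?thesis using t by (simp add: zero_le_mult_iff)
    qed
    have "((\<lambda>t. D + t * K) \<longlongrightarrow> D + 0 * K) (at_right 0)"
      by (intro tendsto_intros)
    moreover have "\<forall>\<^sub>F t in at_right 0. 0 \<le> D + t * K"
      using eventually_at_right_real[of 0 1] by (rule eventually_mono) (auto intro: step)
    ultimately have "0 \<le> D"
      using tendsto_lowerbound[of "\<lambda>t. D + t * K" "D + 0 * K" "at_right 0" 0] by simp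
    then show ?thesis by (simp add: D_def)
  qed
  with v show ?thesis using that by blast
qed

text \<open>
  Uniqueness: adding the variational inequalities of two minimizers, each tested at the
  other, cancels the values of \<open>f\<close> and bounds their squared distance by \<open>0\<close>.
\<close>

lemma Prox_is_arg_min:
  fixes f :: "'a::euclidean_space \<Rightarrow> ereal"
  assumes f: "closed_proper_convex f"
  shows "is_arg_min (\<lambda>y. f y + ereal (1 / 2 * (norm (x - y))\<^sup>2)) (\<lambda>_. True) (Prox f x)"
  unfolding Prox_def
proof (rule theI')
  let ?P = "is_arg_min (\<lambda>y. f y + ereal (1 / 2 * (norm (x - y))\<^sup>2)) (\<lambda>_. True)"
  show "\<exists>!y. ?P y"
  proof (rule ex_ex1I[OF proximal_minimizer_exists[OF f]])
    fix y z assume "?P y" "?P z"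
    obtain v where v: "f y = ereal v" "\<And>z r. f z \<le> ereal r \<Longrightarrow> v + (x - y) \<bullet> (z - y) \<le> r"
      using proximal_variational_inequality[OF f \<open>?P y\<close>] by blast
    obtain w where w: "f z = ereal w" "\<And>y r. f y \<le> ereal r \<Longrightarrow> w + (x - z) \<bullet> (y - z) \<le> r"
      using proximal_variational_inequality[OF f \<open>?P z\<close>] by blast
    have "(x - y) \<bullet> (z - y) + (x - z) \<bullet> (y - z) \<le> 0"
      using v(2)[of z w] w(2)[of y v] v(1) w(1) by simp
    then have "(z - y) \<bullet> (z - y) \<le> 0"
      by (simp add: inner_diff_left inner_diff_right inner_commute)
    then show "y = z" using inner_gt_zero_iff[of "z - y"] by (auto simp: not_less[symmetric])
  qed
qed

lemma closed_proper_convex_scale: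
  fixes f :: "'a::euclidean_space \<Rightarrow> ereal"
  assumes f: "closed_proper_convex f" and b: "0 < b"
  shows "closed_proper_convex (\<lambda>y. ereal b * f y)"
proof -
  have le: "ereal b * f y \<le> ereal r \<longleftrightarrow> f y \<le> ereal (r / b)" for y r
    using b by (cases "f y") (auto simp: field_simps)
  have epi: "ereal_epigraph (\<lambda>y. ereal b * f y) = (\<lambda>(y, r). (y, r / b)) -` ereal_epigraph f"
    by (auto simp: ereal_epigraph_def le)
  have lin: "linear (\<lambda>(y::'a, r). (y, r / b))"
    by (rule linearI) (auto simp: add_divide_distrib)
  have "closed (ereal_epigraph (\<lambda>y. ereal b * f y))"
    unfolding epi using f lin
    by (intro continuous_closed_vimage)
      (auto simp: closed_proper_convex_def linear_continuous_at linear_conv_bounded_linear)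
  moreover have "convex (ereal_epigraph (\<lambda>y. ereal b * f y))"
    unfolding epi using f by (intro convex_linear_vimage[OF lin]) (simp add: closed_proper_convex_def)
  moreover obtain y r where "f y = ereal r" using finite_point_exists[OF f] .
  then have "effective_domain (\<lambda>y. ereal b * f y) \<noteq> {}"
    by (auto simp: effective_domain_def intro!: exI[of _ y])
  moreover have "ereal b * f y \<noteq> -\<infinity>" for y
    using f b by (cases "f y") (auto simp: closed_proper_convex_def)
  ultimately show ?thesis by (simp add: closed_proper_convex_def)
qed

section \<open>The mixed variational inequality and the predictor\<close>

lemma predictor_variational_inequality:
  fixes \<theta> :: "'a::euclidean_space \<Rightarrow> ereal"
  assumes \<theta>: "closed_proper_convex \<theta>" and b: "0 < b" and xt: "xt = predictor \<theta> F b x"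
  obtains v where "\<theta> xt = ereal v"
    "\<And>z r. \<theta> z \<le> ereal r \<Longrightarrow> b * v + (x - b *\<^sub>R F x - xt) \<bullet> (z - xt) \<le> b * r"
proof -
  obtain w where w: "ereal b * \<theta> xt = ereal w"
    "\<And>z r. ereal b * \<theta> z \<le> ereal r \<Longrightarrow> w + (x - b *\<^sub>R F x - xt) \<bullet> (z - xt) \<le> r"
    using proximal_variational_inequality[OF closed_proper_convex_scale[OF \<theta> b]
        Prox_is_arg_min[OF closed_proper_convex_scale[OF \<theta> b]]]
    unfolding xt predictor_def by blast
  obtain v where v: "\<theta> xt = ereal v" using w(1) b by (cases "\<theta> xt") auto
  have "b * v + (x - b *\<^sub>R F x - xt) \<bullet> (z - xt) \<le> b * r" if "\<theta> z \<le> ereal r" for z r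
  proof -
    have "ereal b * \<theta> z \<le> ereal (b * r)"
      using ereal_mult_left_mono[OF that, of "ereal b"] b by simp
    then show ?thesis using w v by auto
  qed
  with v show ?thesis using that by blast
qed

text \<open>
  Finiteness of \<open>\<theta> s\<close> is implicit on both sides: on the right by taking \<open>z\<close> in the
  effective domain, on the left because \<open>\<theta> s = \<infinity>\<close> would make \<open>\<theta> z - \<theta> s = -\<infinity>\<close> for such \<open>z\<close>.
\<close>

lemma MGVI_solution_iff_epigraph:
  fixes \<theta> :: "'a::euclidean_space \<Rightarrow> ereal"
  assumes \<theta>: "closed_proper_convex \<theta>"
  shows "MGVI_solution \<theta> F s \<longleftrightarrow>
    (\<forall>z r. \<theta> z \<le> ereal r \<longrightarrow> \<theta> s \<le> ereal (r + (z - s) \<bullet> F s))" (is "?L \<longleftrightarrow> ?R")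
proof -
  have nm: "\<theta> z \<noteq> -\<infinity>" for z using \<theta> by (simp add: closed_proper_convex_def)
  obtain x0 r0 where x0: "\<theta> x0 = ereal r0" using finite_point_exists[OF \<theta>] .
  show ?thesis
  proof
    assume L: ?L
    then have ineq: "0 \<le> \<theta> z - \<theta> s + ereal ((z - s) \<bullet> F s)" for z
      by (simp add: MGVI_solution_def)
    obtain v where v: "\<theta> s = ereal v"
      using ineq[of x0] x0 nm by (cases "\<theta> s") auto
    show ?R
    proof (intro allI impI)
      fix z r assume "\<theta> z \<le> ereal r"
      then show "\<theta> s \<le> ereal (r + (z - s) \<bullet> F s)"
        using ineq[of z] nm[of z] v by (cases "\<theta> z") auto
    qed
  next
    assume R: ?R
    obtain v where v: "\<theta> s = ereal v"
      using R[rule_format, of x0 r0] x0 nm by (cases "\<theta> s") auto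
    have "0 \<le> \<theta> z - \<theta> s + ereal ((z - s) \<bullet> F s)" for z
    proof (cases "\<theta> z")
      case (real w)
      then show ?thesis using R[rule_format, of z w] v by simp
    qed (use nm v in auto)
    then show ?L by (simp add: MGVI_solution_def)
  qed
qed

text \<open>
  The sum of three inequalities: that of the predictor tested at \<open>s\<close>, that of the solution \<open>s\<close>
  tested at \<open>xt\<close> (the values of \<open>\<theta>\<close> cancel), and monotonicity between \<open>xt\<close> and \<open>s\<close>.
\<close>

lemma predictor_descent_direction:
  fixes \<theta> :: "'a::euclidean_space \<Rightarrow> ereal"
  assumes \<theta>: "closed_proper_convex \<theta>" and F: "monotone_operator F" and s: "MGVI_solution \<theta> F s"
    and b: "0 < b" and xt: "xt = predictor \<theta> F b x"
  shows "(x - xt) \<bullet> ((x - xt) - b *\<^sub>R (F x - F xt)) \<le> (x - s) \<bullet> ((x - xt) - b *\<^sub>R (F x - F xt))"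
proof -
  obtain v where v: "\<theta> xt = ereal v"
    "\<And>z r. \<theta> z \<le> ereal r \<Longrightarrow> b * v + (x - b *\<^sub>R F x - xt) \<bullet> (z - xt) \<le> b * r"
    using predictor_variational_inequality[OF \<theta> b xt] by blast
  have "\<theta> s \<le> ereal (v + (xt - s) \<bullet> F s)"
    using s v(1) by (simp add: MGVI_solution_iff_epigraph[OF \<theta>])
  then have "(x - b *\<^sub>R F x - xt) \<bullet> (s - xt) \<le> b * ((xt - s) \<bullet> F s)"
    using v(2) by (fastforce simp: algebra_simps)
  moreover have "0 \<le> b * ((F xt - F s) \<bullet> (xt - s))"
    using F b by (simp add: monotone_operator_def)
  ultimately have "0 \<le> (xt - s) \<bullet> ((x - xt) - b *\<^sub>R (F x - F xt))"
    by (simp add: inner_diff_left inner_diff_right inner_commute algebra_simps)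
  then show ?thesis by (simp add: inner_diff_left)
qed

text \<open>
  Solving the inequality of the predictor for \<open>\<theta> (xt k)\<close> gives points of the epigraph whose
  second coordinate converges; the lower bound \<open>\<delta>\<close> lets the term
  \<open>(x k - xt k) / b k\<close> vanish in the limit.
\<close>

lemma predictor_cluster_point_solution:
  fixes \<theta> :: "'a::euclidean_space \<Rightarrow> ereal"
  assumes \<theta>: "closed_proper_convex \<theta>" and F: "continuous_on UNIV F"
    and \<delta>: "0 < \<delta>" "\<And>k. \<delta> \<le> b k"
    and x: "x \<longlonglongrightarrow> l" and p: "(\<lambda>k. x k - predictor \<theta> F (b k) (x k)) \<longlonglongrightarrow> 0"
  shows "MGVI_solution \<theta> F l"
  unfolding MGVI_solution_iff_epigraph[OF \<theta>]
proof (intro allI impI)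
  fix z r assume zr: "\<theta> z \<le> ereal r"
  define xt where "xt k = predictor \<theta> F (b k) (x k)" for k
  have b: "0 < b k" for k using \<delta> less_le_trans by blast
  have xt: "xt \<longlonglongrightarrow> l"
    using tendsto_diff[OF x p] by (simp add: xt_def[symmetric])
  have Fx: "(\<lambda>k. F (x k)) \<longlonglongrightarrow> F l"
    using F x by (rule continuous_on_tendsto_compose) auto
  have q: "(\<lambda>k. (1 / b k) *\<^sub>R (x k - xt k)) \<longlonglongrightarrow> 0"
  proof (rule tendsto_norm_zero_cancel, rule tendsto_sandwich[OF _ _ tendsto_const])
    have "(1 / b k) * norm (x k - xt k) \<le> (1 / \<delta>) * norm (x k - xt k)" for k
      using \<delta> by (intro mult_right_mono frac_le) auto
    then show "\<forall>\<^sub>F k in sequentially.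
        norm ((1 / b k) *\<^sub>R (x k - xt k)) \<le> (1 / \<delta>) * norm (x k - xt k)"
      using b by (simp add: less_imp_le)
    show "(\<lambda>k. 1 / \<delta> * norm (x k - xt k)) \<longlonglongrightarrow> 0"
      using tendsto_mult_left[OF tendsto_norm[OF p], of "1 / \<delta>"] by (simp add: xt_def)
  qed auto
  show "\<theta> l \<le> ereal (r + (z - l) \<bullet> F l)"
  proof (rule epigraph_limit[OF \<theta> _ xt])
    show "\<theta> (xt k) \<le> ereal (r - ((1 / b k) *\<^sub>R (x k - xt k) - F (x k)) \<bullet> (z - xt k))" for k
    proof -
      obtain v where v: "\<theta> (xt k) = ereal v"
        "b k * v + (x k - b k *\<^sub>R F (x k) - xt k) \<bullet> (z - xt k) \<le> b k * r"
        using predictor_variational_inequality[OF \<theta> b[of k] xt_def[of k]] zr by blast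
      have "x k - b k *\<^sub>R F (x k) - xt k = b k *\<^sub>R ((1 / b k) *\<^sub>R (x k - xt k) - F (x k))"
        using b[of k] by (simp add: algebra_simps)
      then have "b k * (v + ((1 / b k) *\<^sub>R (x k - xt k) - F (x k)) \<bullet> (z - xt k)) \<le> b k * r"
        using v(2) by (simp add: distrib_left)
      then have "v + ((1 / b k) *\<^sub>R (x k - xt k) - F (x k)) \<bullet> (z - xt k) \<le> r"
        using b[of k] by (rule mult_left_le_imp_le)
      then show ?thesis using v(1) by simp
    qed
    have "(\<lambda>k. r - ((1 / b k) *\<^sub>R (x k - xt k) - F (x k)) \<bullet> (z - xt k))
        \<longlonglongrightarrow> r - (0 - F l) \<bullet> (z - l)"
      by (intro tendsto_intros q Fx xt)
    then show "(\<lambda>k. r - ((1 / b k) *\<^sub>R (x k - xt k) - F (x k)) \<bullet> (z - xt k))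
        \<longlonglongrightarrow> r + (z - l) \<bullet> F l"
      by (simp add: inner_commute)
  qed
qed

section \<open>Fejer monotone sequences\<close>

text \<open>
  The function \<open>\<phi>\<close> plays the role of a squared norm, so that the lemma serves the Euclidean norm
  and the norm of a positive definite matrix alike. For every \<open>s\<close> in \<open>S\<close> the values
  \<open>\<phi> (x k - s)\<close> decrease, which gives boundedness and \<open>p \<longlonglongrightarrow> 0\<close>. Applied to a
  cluster point \<open>l\<close> in \<open>S\<close>, their limit is \<open>0\<close> because it is \<open>0\<close> along a subsequence.
\<close>

lemma fejer_monotone_convergence:
  fixes x p :: "nat \<Rightarrow> 'a::euclidean_space" and \<phi> :: "'a \<Rightarrow> real"
  assumes \<phi>: "continuous_on UNIV \<phi>" "\<phi> 0 = 0" and m: "0 < m" "\<And>e. m * (norm e)\<^sup>2 \<le> \<phi> e"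
    and c: "0 < c" and S: "S \<noteq> {}"
    and dec: "\<And>s k. s \<in> S \<Longrightarrow> \<phi> (x (Suc k) - s) \<le> \<phi> (x k - s) - c * (norm (p k))\<^sup>2"
    and cluster: "\<And>q l. strict_mono q \<Longrightarrow> (x \<circ> q) \<longlonglongrightarrow> l \<Longrightarrow> (p \<circ> q) \<longlonglongrightarrow> 0 \<Longrightarrow> l \<in> S"
  shows "\<exists>s\<in>S. x \<longlonglongrightarrow> s"
proof -
  obtain s where s: "s \<in> S" using S by blast
  have nonneg: "0 \<le> \<phi> e" for e
    using m(1) m(2)[of e] by (meson mult_nonneg_nonneg order_trans less_imp_le zero_le_power2)
  have decs: "decseq (\<lambda>k. \<phi> (x k - s))" if "s \<in> S" for s
  proof (rule decseq_SucI)
    fix k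
    show "\<phi> (x (Suc k) - s) \<le> \<phi> (x k - s)"
      using dec[OF that, of k] mult_nonneg_nonneg[of c "(norm (p k))\<^sup>2"] c
      by (smt (verit) zero_le_power2)
  qed
  have le: "norm e \<le> sqrt (\<phi> e / m)" for e
    using m by (intro real_le_rsqrt) (simp add: field_simps)
  obtain L where L: "(\<lambda>k. \<phi> (x k - s)) \<longlonglongrightarrow> L"
    using decseq_convergent[OF decs[OF s], where B = 0] nonneg by blast
  have p0: "p \<longlonglongrightarrow> 0"
  proof (rule tendsto_norm_zero_cancel)
    have "(\<lambda>k. (1 / c) * (\<phi> (x k - s) - \<phi> (x (Suc k) - s))) \<longlonglongrightarrow> (1 / c) * (L - L)"
      using LIMSEQ_Suc[OF L] by (intro tendsto_intros L)
    then have lim: "(\<lambda>k. (1 / c) * (\<phi> (x k - s) - \<phi> (x (Suc k) - s))) \<longlonglongrightarrow> 0" by simp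
    have "(\<lambda>k. (norm (p k))\<^sup>2) \<longlonglongrightarrow> 0"
    proof (rule tendsto_sandwich[OF _ _ tendsto_const lim])
      have "(norm (p k))\<^sup>2 \<le> (1 / c) * (\<phi> (x k - s) - \<phi> (x (Suc k) - s))" for k
        using dec[OF s, of k] c by (simp add: field_simps)
      then show "\<forall>\<^sub>F k in sequentially.
          (norm (p k))\<^sup>2 \<le> (1 / c) * (\<phi> (x k - s) - \<phi> (x (Suc k) - s))"
        by simp
    qed simp
    then show "(\<lambda>k. norm (p k)) \<longlonglongrightarrow> 0"
      using tendsto_real_sqrt[of "\<lambda>k. (norm (p k))\<^sup>2" 0] by simp
  qed
  have "bounded (range x)"
  proof (rule bounded_subset)
    show "range x \<subseteq> cball s (sqrt (\<phi> (x 0 - s) / m))"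
    proof (rule image_subsetI)
      fix k
      have "norm (x k - s) \<le> sqrt (\<phi> (x k - s) / m)" by (rule le)
      also have "\<dots> \<le> sqrt (\<phi> (x 0 - s) / m)"
        using decseqD[OF decs[OF s], of 0 k] m(1) by (simp add: divide_right_mono)
      finally show "x k \<in> cball s (sqrt (\<phi> (x 0 - s) / m))"
        by (simp add: dist_norm norm_minus_commute)
    qed
  qed simp
  then obtain l and q :: "nat \<Rightarrow> nat" where q: "strict_mono q" "(x \<circ> q) \<longlonglongrightarrow> l"
    using bounded_imp_convergent_subsequence by blast
  have l: "l \<in> S"
    using cluster[OF q] LIMSEQ_subseq_LIMSEQ[OF p0 q(1)] by blast
  obtain L' where L': "(\<lambda>k. \<phi> (x k - l)) \<longlonglongrightarrow> L'"
    using decseq_convergent[OF decs[OF l], where B = 0] nonneg by blast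
  have "(\<lambda>k. \<phi> ((x \<circ> q) k - l)) \<longlonglongrightarrow> \<phi> (l - l)"
    by (rule continuous_on_tendsto_compose[OF \<phi>(1)]) (intro tendsto_intros q, auto)
  moreover have "(\<lambda>k. \<phi> ((x \<circ> q) k - l)) \<longlonglongrightarrow> L'"
    using LIMSEQ_subseq_LIMSEQ[OF L' q(1)] by (simp add: comp_def)
  ultimately have "L' = 0" using LIMSEQ_unique \<phi>(2) by fastforce
  then have "(\<lambda>k. sqrt (\<phi> (x k - l) / m)) \<longlonglongrightarrow> sqrt (0 / m)"
    using L' m(1) by (intro tendsto_intros) auto
  then have lim: "(\<lambda>k. sqrt (\<phi> (x k - l) / m)) \<longlonglongrightarrow> 0" by simp
  have "(\<lambda>k. norm (x k - l)) \<longlonglongrightarrow> 0"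
    by (rule tendsto_sandwich[OF _ _ tendsto_const lim]) (simp_all add: le)
  then have "x \<longlonglongrightarrow> l" by (simp add: LIM_zero_iff tendsto_norm_zero_iff)
  with l show ?thesis by blast
qed

section \<open>The prediction-correction method with variable step sizes\<close>

text \<open>
  By the step criterion and Cauchy-Schwarz, \<open>p \<bullet> d \<ge> (1 - \<nu>) * (norm p)\<^sup>2\<close> and
  \<open>norm d \<le> (1 + \<nu>) * norm p\<close>. Since \<open>\<alpha>\<^sup>2 * (norm d)\<^sup>2 = \<alpha> * (p \<bullet> d)\<close>, expanding the square of
  the new distance leaves a decrease of \<open>\<gamma> * (2 - \<gamma>) * \<alpha> * (p \<bullet> d)\<close>, where
  \<open>\<alpha> * (p \<bullet> d) = (p \<bullet> d)\<^sup>2 / (norm d)\<^sup>2\<close>.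
\<close>

lemma PGA_b1_contraction:
  fixes \<theta> :: "'a::euclidean_space \<Rightarrow> ereal"
  assumes \<theta>: "closed_proper_convex \<theta>" and F: "monotone_operator F" and s: "MGVI_solution \<theta> F s"
    and \<gamma>: "0 < \<gamma>" "\<gamma> < 2" and \<nu>: "0 < \<nu>" "\<nu> < 1" and x: "PGA_b1 \<theta> F \<nu> \<gamma> \<beta> x"
  shows "(norm (x (Suc k) - s))\<^sup>2 \<le> (norm (x k - s))\<^sup>2
    - \<gamma> * (2 - \<gamma>) * ((1 - \<nu>) / (1 + \<nu>))\<^sup>2 * (norm (x k - predictor \<theta> F (\<beta> k) (x k)))\<^sup>2"
proof -
  define xt where "xt = predictor \<theta> F (\<beta> k) (x k)"
  define p where "p = x k - xt"
  define g where "g = \<beta> k *\<^sub>R (F (x k) - F xt)"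
  define d where "d = p - g"
  define \<alpha> where "\<alpha> = (p \<bullet> d) / (norm d)\<^sup>2"
  have b: "0 < \<beta> k" and step: "\<beta> k * norm (F (x k) - F xt) \<le> \<nu> * norm p"
    and next_x: "x (Suc k) = (if x k = xt then x k else x k - (\<gamma> * \<alpha>) *\<^sub>R d)"
    using x by (simp_all add: PGA_b1_def Let_def xt_def p_def g_def d_def \<alpha>_def)
  have g: "norm g \<le> \<nu> * norm p" using step b by (simp add: g_def)
  show ?thesis
  proof (cases "x k = xt")
    case True
    then have "x k - predictor \<theta> F (\<beta> k) (x k) = 0" by (simp add: xt_def)
    then show ?thesis using next_x True by simp
  next
    case False
    then have p: "0 < norm p" by (simp add: p_def)
    have "p \<bullet> g \<le> norm p * (\<nu> * norm p)"
      using norm_cauchy_schwarz[of p g] mult_left_mono[OF g, of "norm p"] by simp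
    then have pd: "(1 - \<nu>) * (norm p)\<^sup>2 \<le> p \<bullet> d"
      by (simp add: d_def inner_diff_right power2_norm_eq_inner[symmetric] power2_eq_square algebra_simps)
    have "0 < (1 - \<nu>) * (norm p)\<^sup>2" using \<nu> p by simp
    with pd have pd0: "0 < p \<bullet> d" by linarith
    then have d0: "0 < norm d" by auto
    have "norm d \<le> norm p + norm g" unfolding d_def by (rule norm_triangle_ineq4)
    then have "norm d \<le> (1 + \<nu>) * norm p" using g by (simp add: algebra_simps)
    then have d2: "(norm d)\<^sup>2 \<le> ((1 + \<nu>) * norm p)\<^sup>2" by (intro power_mono) auto
    have \<alpha>pd: "\<alpha> * (p \<bullet> d) = (p \<bullet> d)\<^sup>2 / (norm d)\<^sup>2"
      by (simp add: \<alpha>_def power2_eq_square)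
    have "(1 - \<nu>) / (1 + \<nu>) * norm p = ((1 - \<nu>) * (norm p)\<^sup>2) / ((1 + \<nu>) * norm p)"
      using p by (simp add: power2_eq_square)
    then have "((1 - \<nu>) / (1 + \<nu>))\<^sup>2 * (norm p)\<^sup>2
        = ((1 - \<nu>) * (norm p)\<^sup>2)\<^sup>2 / ((1 + \<nu>) * norm p)\<^sup>2"
      by (simp only: power_mult_distrib[symmetric] power_divide[symmetric])
    also have "\<dots> \<le> (p \<bullet> d)\<^sup>2 / (norm d)\<^sup>2"
      using pd d2 d0 \<nu> by (intro frac_le power_mono) auto
    finally have main: "((1 - \<nu>) / (1 + \<nu>))\<^sup>2 * (norm p)\<^sup>2 \<le> \<alpha> * (p \<bullet> d)" by (simp add: \<alpha>pd)
    have "p \<bullet> d \<le> (x k - s) \<bullet> d"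
      using predictor_descent_direction[OF \<theta> F s b xt_def] by (simp add: p_def d_def g_def)
    moreover have "0 \<le> 2 * \<gamma> * \<alpha>" using \<gamma> pd0 by (simp add: \<alpha>_def)
    ultimately have sd: "2 * \<gamma> * \<alpha> * (p \<bullet> d) \<le> 2 * \<gamma> * \<alpha> * ((x k - s) \<bullet> d)"
      by (rule mult_left_mono)
    have add: "\<alpha>\<^sup>2 * (norm d)\<^sup>2 = \<alpha> * (p \<bullet> d)"
      using d0 by (simp add: \<alpha>_def power2_eq_square)
    have next_e: "x (Suc k) - s = (x k - s) - (\<gamma> * \<alpha>) *\<^sub>R d" using next_x False by simp
    have "(norm (x (Suc k) - s))\<^sup>2
        = (norm (x k - s))\<^sup>2 - 2 * \<gamma> * \<alpha> * ((x k - s) \<bullet> d) + \<gamma>\<^sup>2 * (\<alpha>\<^sup>2 * (norm d)\<^sup>2)"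
      unfolding next_e norm_diff_scaleR_squared by (simp add: power_mult_distrib)
    also have "\<dots> \<le> (norm (x k - s))\<^sup>2 - \<gamma> * (2 - \<gamma>) * (\<alpha> * (p \<bullet> d))"
      unfolding add using sd by (simp add: power2_eq_square algebra_simps)
    also have "\<dots> \<le> (norm (x k - s))\<^sup>2 - \<gamma> * (2 - \<gamma>) * (((1 - \<nu>) / (1 + \<nu>))\<^sup>2 * (norm p)\<^sup>2)"
      using main \<gamma> by (intro diff_left_mono mult_left_mono) auto
    finally show ?thesis by (simp add: p_def xt_def mult.assoc)
  qed
qed

theorem PGA_b1_convergence:
  fixes \<theta> :: "'a::euclidean_space \<Rightarrow> ereal"
  assumes \<theta>: "closed_proper_convex \<theta>" and F: "monotone_operator F" "continuous_on UNIV F"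
    and sol: "\<exists>s. MGVI_solution \<theta> F s"
    and \<gamma>: "0 < \<gamma>" "\<gamma> < 2" and \<nu>: "0 < \<nu>" "\<nu> < 1" and x: "PGA_b1 \<theta> F \<nu> \<gamma> \<beta> x"
    and \<beta>: "0 < \<delta>" "\<And>k. \<delta> \<le> \<beta> k"
  shows "\<exists>s. MGVI_solution \<theta> F s \<and> x \<longlonglongrightarrow> s"
proof -
  let ?p = "\<lambda>k. x k - predictor \<theta> F (\<beta> k) (x k)"
  have "\<exists>s\<in>{s. MGVI_solution \<theta> F s}. x \<longlonglongrightarrow> s"
  proof (rule fejer_monotone_convergence[where \<phi> = "\<lambda>e. (norm e)\<^sup>2" and m = 1 and p = ?p])
    show "0 < \<gamma> * (2 - \<gamma>) * ((1 - \<nu>) / (1 + \<nu>))\<^sup>2" using \<gamma> \<nu> by simp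
    show "continuous_on UNIV (\<lambda>e::'a. (norm e)\<^sup>2)" by (intro continuous_intros)
    show "(norm (x (Suc k) - s))\<^sup>2
        \<le> (norm (x k - s))\<^sup>2 - \<gamma> * (2 - \<gamma>) * ((1 - \<nu>) / (1 + \<nu>))\<^sup>2 * (norm (?p k))\<^sup>2"
      if "s \<in> {s. MGVI_solution \<theta> F s}" for s k
      using PGA_b1_contraction[OF \<theta> F(1) _ \<gamma> \<nu> x] that by blast
    show "l \<in> {s. MGVI_solution \<theta> F s}"
      if "(x \<circ> q) \<longlonglongrightarrow> l" "(?p \<circ> q) \<longlonglongrightarrow> 0" for q l
      using predictor_cluster_point_solution[OF \<theta> F(2) \<beta>(1), of "\<beta> \<circ> q" "x \<circ> q" l] \<beta>(2) that
      by (simp add: comp_def)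
  qed (use sol in auto)
  then show ?thesis by blast
qed

section \<open>The Rayleigh quotient of a symmetric positive semidefinite matrix\<close>

lemma symmetric_inner_commute:
  fixes A :: "real^'n^'n"
  assumes "transpose A = A"
  shows "u \<bullet> (A *v w) = (A *v u) \<bullet> w"
  using assms by (metis dot_lmul_matrix transpose_matrix_vector)

text \<open>
  Eigenvectors of distinct eigenvalues are orthogonal, so choosing one for each eigenvalue
  yields a linearly independent set.
\<close>

lemma finite_eigenvalues_symmetric:
  fixes A :: "real^'n^'n"
  assumes A: "transpose A = A"
  shows "finite (eigenvalues A)"
proof -
  have "\<forall>l\<in>eigenvalues A. \<exists>v. v \<noteq> 0 \<and> A *v v = l *\<^sub>R v" by (auto simp: eigenvalues_def)
  then obtain v where v: "\<And>l. l \<in> eigenvalues A \<Longrightarrow> v l \<noteq> 0 \<and> A *v v l = l *\<^sub>R v l" by metis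
  have orth: "v l \<bullet> v k = 0" if "l \<in> eigenvalues A" "k \<in> eigenvalues A" "l \<noteq> k" for l k
  proof -
    have "k * (v l \<bullet> v k) = l * (v l \<bullet> v k)"
      using symmetric_inner_commute[OF A, of "v l" "v k"] v that by simp
    then show ?thesis using that by simp
  qed
  have inj: "inj_on v (eigenvalues A)"
  proof (rule inj_onI, rule ccontr)
    fix l k assume "l \<in> eigenvalues A" "k \<in> eigenvalues A" "v l = v k" "l \<noteq> k"
    then show False using orth[of l k] v[of k] by simp
  qed
  have "independent (v ` eigenvalues A)"
  proof (rule pairwise_orthogonal_independent)
    show "pairwise orthogonal (v ` eigenvalues A)"
      using orth by (auto simp: pairwise_def orthogonal_def)
    show "0 \<notin> v ` eigenvalues A" using v by fastforce
  qed
  then have "finite (v ` eigenvalues A)" by (rule finiteI_independent)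
  then show ?thesis using inj finite_image_iff by blast
qed

text \<open>
  If \<open>w = B *v v\<close> were nonzero, the form would become negative on moving from \<open>v\<close> slightly
  in the direction \<open>- w\<close>, since its linear term there is \<open>- 2 * t * (w \<bullet> w)\<close>.
\<close>

lemma psd_form_zero_imp_kernel:
  fixes B :: "real^'n^'n"
  assumes B: "transpose B = B" and psd: "\<And>x. 0 \<le> x \<bullet> (B *v x)" and v: "v \<bullet> (B *v v) = 0"
  shows "B *v v = 0"
proof (rule ccontr)
  define w where "w = B *v v"
  assume "B *v v \<noteq> 0"
  then have w: "0 < w \<bullet> w" by (simp add: w_def)
  define K where "K = w \<bullet> (B *v w)"
  have K: "0 \<le> K" using psd by (simp add: K_def)
  have vw: "v \<bullet> (B *v w) = w \<bullet> w" using symmetric_inner_commute[OF B, of v w] by (simp add: w_def)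
  have "0 \<le> - 2 * t * (w \<bullet> w) + t\<^sup>2 * K" for t
    using psd[of "v - t *\<^sub>R w"] v vw
    by (simp add: matrix_vector_mult_diff_distrib matrix_vector_mult_scaleR inner_diff_left
        inner_diff_right w_def[symmetric] K_def[symmetric] power2_eq_square algebra_simps)
  \<comment> \<open>the minimizer \<open>(w \<bullet> w) / K\<close> of the quadratic in \<open>t\<close>, shifted to stay defined for \<open>K = 0\<close>\<close>
  moreover define t where "t = (w \<bullet> w) / (K + 1)"
  ultimately have "0 \<le> - 2 * t * (w \<bullet> w) + t\<^sup>2 * K" by blast
  moreover have "w \<bullet> w = t * (K + 1)" using K by (simp add: t_def)
  ultimately have "0 \<le> - (t\<^sup>2 * (K + 2))" by (simp add: power2_eq_square algebra_simps)
  moreover have "0 < t" using w K by (simp add: t_def)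
  then have "0 < t\<^sup>2 * (K + 2)" using K by simp
  ultimately show False by linarith
qed

text \<open>
  The quadratic form attains a maximum \<open>l\<close> over the unit sphere at some \<open>v\<close>. Then
  \<open>l I - A\<close> is positive semidefinite and its form vanishes at \<open>v\<close>, so \<open>v\<close> lies
  in its kernel: the maximum of the Rayleigh quotient is an eigenvalue.
\<close>

lemma rayleigh_quotient_le_lambda_max:
  fixes A :: "real^'n^'n"
  assumes A: "symmetric_psd A"
  shows "x \<bullet> (A *v x) \<le> lambda_max A * (x \<bullet> x)" and "0 \<le> lambda_max A"
proof -
  have sym: "transpose A = A" and psd: "\<And>x. 0 \<le> x \<bullet> (A *v x)"
    using A by (auto simp: symmetric_psd_def)
  have "continuous_on (sphere 0 1) (\<lambda>v::real^'n. v \<bullet> (A *v v))"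
    by (intro continuous_intros matrix_vector_mult_linear_continuous_on)
  moreover have "sphere (0::real^'n) 1 \<noteq> {}" by simp
  ultimately obtain v :: "real^'n" where v_sphere: "v \<in> sphere 0 1"
    and v_sup: "\<forall>u\<in>sphere 0 1. u \<bullet> (A *v u) \<le> v \<bullet> (A *v v)"
    using continuous_attains_sup[OF compact_sphere] by blast
  have v: "norm v = 1" using v_sphere by simp
  have vmax: "u \<bullet> (A *v u) \<le> v \<bullet> (A *v v)" if "norm u = 1" for u
    using v_sup that by simp
  define l where "l = v \<bullet> (A *v v)"
  have ray: "u \<bullet> (A *v u) \<le> l * (u \<bullet> u)" for u
  proof (cases "u = 0")
    case False
    define t where "t = norm u"
    have t: "0 < t" using False by (simp add: t_def)
    have "((1/t) *\<^sub>R u) \<bullet> (A *v ((1/t) *\<^sub>R u)) \<le> l"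
      unfolding l_def using t by (intro vmax) (simp add: t_def)
    then have "(u \<bullet> (A *v u)) / (t * t) \<le> l" by (simp add: matrix_vector_mult_scaleR)
    then show ?thesis
      using t by (simp add: field_simps t_def power2_norm_eq_inner[symmetric] power2_eq_square)
  qed simp
  define B where "B = mat l - A"
  have mat_l: "mat l *v u = l *\<^sub>R u" for u :: "real^'n"
    by (simp add: mat_def matrix_vector_mult_def vec_eq_iff if_distrib[of "\<lambda>c. c * _"] cong: if_cong)
  have Bv: "B *v u = l *\<^sub>R u - A *v u" for u
    by (simp add: B_def matrix_vector_mult_diff_rdistrib mat_l)
  have "transpose B = B"
    using sym by (simp add: B_def transpose_def mat_def vec_eq_iff)
  moreover have "0 \<le> u \<bullet> (B *v u)" for u using ray[of u] by (simp add: Bv inner_diff_right)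
  moreover have "v \<bullet> (B *v v) = 0"
    using v by (simp add: Bv inner_diff_right l_def[symmetric] power2_norm_eq_inner[symmetric])
  ultimately have "B *v v = 0" by (rule psd_form_zero_imp_kernel)
  then have "A *v v = l *\<^sub>R v" by (simp add: Bv)
  moreover have "v \<noteq> 0" using v by auto
  ultimately have "l \<in> eigenvalues A" by (auto simp: eigenvalues_def)
  then have le: "l \<le> lambda_max A"
    unfolding lambda_max_def by (rule Max_ge[OF finite_eigenvalues_symmetric[OF sym]])
  have "l * (x \<bullet> x) \<le> lambda_max A * (x \<bullet> x)" using le by (intro mult_right_mono) auto
  with ray[of x] show "x \<bullet> (A *v x) \<le> lambda_max A * (x \<bullet> x)" by linarith
  have "0 \<le> l" using psd by (simp add: l_def)
  with le show "0 \<le> lambda_max A" by linarith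
qed

section \<open>The method for affine operators with constant step size\<close>

text \<open>
  Here \<open>d = M p\<close>, so the descent inequality reads \<open>p \<bullet> M p \<le> e \<bullet> M p\<close> with \<open>e = x - s\<close>, and the
  form \<open>e \<bullet> M e\<close> decreases under the step \<open>e - \<gamma> *\<^sub>R p\<close> by at least
  \<open>\<gamma> * (2 - \<gamma>) * (p \<bullet> M p)\<close>.
\<close>

theorem PGA_b2_convergence:
  fixes \<theta> :: "real^'n \<Rightarrow> ereal" and A :: "real^'n^'n"
  assumes \<theta>: "closed_proper_convex \<theta>" and A: "symmetric_psd A" and F: "\<And>x. F x = A *v x + c"
    and sol: "\<exists>s. MGVI_solution \<theta> F s"
    and \<gamma>: "0 < \<gamma>" "\<gamma> < 2" and \<beta>: "0 < \<beta>" "\<beta> * lambda_max A < 1"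
    and y: "PGA_b2 \<theta> F \<gamma> \<beta> y"
  shows "\<exists>s. MGVI_solution \<theta> F s \<and> y \<longlonglongrightarrow> s"
proof -
  let ?p = "\<lambda>k. y k - predictor \<theta> F \<beta> (y k)"
  define M where "M e = e - \<beta> *\<^sub>R (A *v e)" for e
  define m where "m = 1 - \<beta> * lambda_max A"
  have m: "0 < m" using \<beta> by (simp add: m_def)
  have sym: "transpose A = A" and psd: "\<And>x. 0 \<le> x \<bullet> (A *v x)"
    using A by (auto simp: symmetric_psd_def)
  have mono: "monotone_operator F"
    using psd unfolding monotone_operator_def F
    by (simp add: matrix_vector_mult_diff_distrib[symmetric] inner_commute)
  have cont: "continuous_on UNIV F"
    unfolding F[abs_def] by (intro continuous_intros matrix_vector_mult_linear_continuous_on)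
  have M_pos: "m * (norm e)\<^sup>2 \<le> e \<bullet> M e" for e
  proof -
    have "\<beta> * (e \<bullet> (A *v e)) \<le> \<beta> * (lambda_max A * (e \<bullet> e))"
      using \<beta>(1) by (intro mult_left_mono rayleigh_quotient_le_lambda_max[OF A]) auto
    then show ?thesis
      by (simp add: M_def m_def inner_diff_right power2_norm_eq_inner algebra_simps)
  qed
  have M_lin: "M (u - t *\<^sub>R w) = M u - t *\<^sub>R M w" for u w t
    by (simp add: M_def matrix_vector_mult_diff_distrib matrix_vector_mult_scaleR algebra_simps)
  have M_sym: "w \<bullet> M u = u \<bullet> M w" for u w
    using symmetric_inner_commute[OF sym, of u w]
    by (simp add: M_def inner_diff_right inner_commute)
  have "\<exists>s\<in>{s. MGVI_solution \<theta> F s}. y \<longlonglongrightarrow> s"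
  proof (rule fejer_monotone_convergence[where \<phi> = "\<lambda>e. e \<bullet> M e" and p = ?p, OF _ _ m M_pos])
    show "0 < \<gamma> * (2 - \<gamma>) * m" using \<gamma> m by simp
    show "continuous_on UNIV (\<lambda>e. e \<bullet> M e)"
      unfolding M_def by (intro continuous_intros matrix_vector_mult_linear_continuous_on)
    show "(y (Suc k) - s) \<bullet> M (y (Suc k) - s)
        \<le> (y k - s) \<bullet> M (y k - s) - \<gamma> * (2 - \<gamma>) * m * (norm (?p k))\<^sup>2"
      if s: "s \<in> {s. MGVI_solution \<theta> F s}" for s k
    proof -
      define p where "p = ?p k"
      define e where "e = y k - s"
      have "p - \<beta> *\<^sub>R (F (y k) - F (predictor \<theta> F \<beta> (y k))) = M p"
        by (simp add: F M_def p_def matrix_vector_mult_diff_distrib)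
      then have pe: "p \<bullet> M p \<le> e \<bullet> M p"
        using predictor_descent_direction[OF \<theta> mono _ \<beta>(1) refl, of s "y k"] s
        by (simp add: p_def e_def)
      have next_e: "y (Suc k) - s = e - \<gamma> *\<^sub>R p" using y by (simp add: PGA_b2_def e_def p_def)
      have "(y (Suc k) - s) \<bullet> M (y (Suc k) - s)
          = e \<bullet> M e - 2 * \<gamma> * (e \<bullet> M p) + \<gamma>\<^sup>2 * (p \<bullet> M p)"
        unfolding next_e M_lin using M_sym[of p e]
        by (simp add: inner_diff_left inner_diff_right power2_eq_square algebra_simps)
      also have "\<dots> \<le> e \<bullet> M e - \<gamma> * (2 - \<gamma>) * (p \<bullet> M p)"
        using mult_left_mono[OF pe, of "2 * \<gamma>"] \<gamma> by (simp add: power2_eq_square algebra_simps)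
      also have "\<dots> \<le> e \<bullet> M e - \<gamma> * (2 - \<gamma>) * (m * (norm p)\<^sup>2)"
        using M_pos[of p] \<gamma> by (intro diff_left_mono mult_left_mono) auto
      finally show ?thesis by (simp add: p_def e_def mult.assoc)
    qed
    show "l \<in> {s. MGVI_solution \<theta> F s}"
      if "(y \<circ> q) \<longlonglongrightarrow> l" "(?p \<circ> q) \<longlonglongrightarrow> 0" for q l
      using predictor_cluster_point_solution[OF \<theta> cont \<beta>(1), of "\<lambda>_. \<beta>" "y \<circ> q" l] that
      by (simp add: comp_def)
  qed (use sol in \<open>auto simp: M_def\<close>)
  then show ?thesis by blast
qed

section \<open>Convergence of both methods\<close>

theorem theorem4p2:
  fixes \<theta> :: "real^'n \<Rightarrow> ereal" and \<gamma> :: real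
  assumes "closed_proper_convex \<theta>" and "0 < \<gamma>" and "\<gamma> < 2"
  shows "(\<forall>(F :: real^'n \<Rightarrow> real^'n) (L :: real) (\<nu> :: real) (\<beta> :: nat \<Rightarrow> real) (x :: nat \<Rightarrow> real^'n).
            monotone_operator F \<longrightarrow> 0 < L \<longrightarrow> L-lipschitz_on UNIV F \<longrightarrow>
            (\<exists>s. MGVI_solution \<theta> F s) \<longrightarrow>
            0 < \<nu> \<longrightarrow> \<nu> < 1 \<longrightarrow>
            PGA_b1 \<theta> F \<nu> \<gamma> \<beta> x \<longrightarrow>
            bounded (range \<beta>) \<longrightarrow> 0 < (INF k. \<beta> k) \<longrightarrow>
            (\<exists>s. MGVI_solution \<theta> F s \<and> x \<longlonglongrightarrow> s))
       \<and> (\<forall>(A :: real^'n^'n) (c :: real^'n) (F :: real^'n \<Rightarrow> real^'n) (\<beta> :: real) (y :: nat \<Rightarrow> real^'n).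
            symmetric_psd A \<longrightarrow> (\<forall>x. F x = A *v x + c) \<longrightarrow>
            (\<exists>s. MGVI_solution \<theta> F s) \<longrightarrow>
            0 < \<beta> \<longrightarrow> (lambda_max A \<noteq> 0 \<longrightarrow> \<beta> < 1 / lambda_max A) \<longrightarrow>
            PGA_b2 \<theta> F \<gamma> \<beta> y \<longrightarrow>
            (\<exists>s. MGVI_solution \<theta> F s \<and> y \<longlonglongrightarrow> s))"
proof (intro conjI allI impI)
  fix F :: "real^'n \<Rightarrow> real^'n" and L \<nu> :: real and \<beta> :: "nat \<Rightarrow> real" and x :: "nat \<Rightarrow> real^'n"
  assume F: "monotone_operator F" "L-lipschitz_on UNIV F" and sol: "\<exists>s. MGVI_solution \<theta> F s"
    and \<nu>: "0 < \<nu>" "\<nu> < 1" and x: "PGA_b1 \<theta> F \<nu> \<gamma> \<beta> x"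
    and \<beta>: "bounded (range \<beta>)" "0 < (INF k. \<beta> k)"
  have "(INF k. \<beta> k) \<le> \<beta> k" for k
    using \<beta>(1) by (intro cINF_lower bounded_imp_bdd_below) auto
  then show "\<exists>s. MGVI_solution \<theta> F s \<and> x \<longlonglongrightarrow> s"
    using PGA_b1_convergence[OF assms(1) F(1) lipschitz_on_continuous_on[OF F(2)] sol
        assms(2,3) \<nu> x \<beta>(2)] by blast
next
  fix A :: "real^'n^'n" and c :: "real^'n" and F :: "real^'n \<Rightarrow> real^'n" and \<beta> :: real
    and y :: "nat \<Rightarrow> real^'n"
  assume A: "symmetric_psd A" and F: "\<forall>x. F x = A *v x + c" and sol: "\<exists>s. MGVI_solution \<theta> F s"
    and \<beta>: "0 < \<beta>" "lambda_max A \<noteq> 0 \<longrightarrow> \<beta> < 1 / lambda_max A" and y: "PGA_b2 \<theta> F \<gamma> \<beta> y"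
  have "\<beta> * lambda_max A < 1"
    using \<beta>(2) rayleigh_quotient_le_lambda_max(2)[OF A]
    by (cases "lambda_max A = 0") (auto simp: field_simps)
  then show "\<exists>s. MGVI_solution \<theta> F s \<and> y \<longlonglongrightarrow> s"
    using PGA_b2_convergence[OF assms(1) A _ sol assms(2,3) \<beta>(1) _ y] F by blast
qed

end
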